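(* Let $\mathcal{K}^{AB}\subseteq\mathbb{C}_h^{nm\times nm}$ be a maximal SDG. Assume that its dual is $\mathcal{M}^{AB}=\{\rho^{AB}\in\mathcal{D}_h^{nm\times nm} : \rho^{AB}=\rho^A\otimes\rho^B\}$, i.e. the singleton $\{\rho^A\otimes\rho^B\}$, with $\rho^A\in\mathcal{D}_h^{n\times n}$ and $\rho^B\in\mathcal{D}_h^{m\times m}$, and that $\mathrm{Tr}(\Pi_i^B\rho^B\Pi_i^B)>0$ for any projector $\Pi_i^B$ of any projection measurement $\Pi^B$ on $\mathbb{C}^m$. Then $\mathcal{K}^{AB}$ satisfies epistemic independence of $A$ and $B$.
   Context: $\mathbb{C}_h^{k\times k}$ is the real vector space of $k\times k$ complex Hermitian matrices, with inner product $G\cdot R=\mathrm{Tr}(G^\dagger R)$. $G\gneq 0$ means $G$ is positive semi-definite and $G\ne 0$; $G>0$ means positive definite. $\mathcal{D}_h^{k\times k}$ is the set of $k\times k$ density matrices (positive semi-definite, trace one). $I_k$ is the $k\times k$ identity. A set $\mathcal{K}\subseteq\mathbb{C}_h^{k\times k}$ is a coherent set of strictly desirable gambles (SDG) if: (S1) it is closed under addition and under multiplication by reals $\nu>0$, and $0\notin\mathcal{K}$; (S2) every $G\gneq 0$ belongs to $\mathcal{K}$; (S3) if $G\in\mathcal{K}$ then either $G\gneq 0$ or $G-\Delta\in\mathcal{K}$ for some $\Delta>0$. It is maximal if no other SDG includes it. The dual of $\mathcal{K}$ is $\{\rho\in\mathcal{D}_h^{k\times k}\mid G\cdot\rho\ge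 0\ \forall G\in\mathcal{K}\}$. A projection measurement on $\mathbb{C}^k$ is a family of $k$ nonzero (hence rank-one) Hermitian matrices $\Pi_1,\dots,\Pi_k$ with $\Pi_i^2=\Pi_i$, $\Pi_i\Pi_j=0$ for $i\neq j$, $\sum_i\Pi_i=I_k$. For an SDG $\mathcal{K}^{AB}\subseteq\mathbb{C}_h^{nm\times nm}$ (composite system of $A$ with dimension $n$ and $B$ with dimension $m$): $\mathrm{marg}_A(\mathcal{K}^{AB})=\{G\in\mathbb{C}_h^{n\times n}\mid G\otimes I_m\in\mathcal{K}^{AB}\}$ and $\mathrm{marg}_B(\mathcal{K}^{AB})=\{G\in\mathbb{C}_h^{m\times m}\mid I_n\otimes G\in\mathcal{K}^{AB}\}$ (same definition for any subset of $\mathbb{C}_h^{nm\times nm}$). $\mathcal{K}^{AB}$ satisfies epistemic irrelevance of $A$ to $B$ if, for each projection measurement $\Pi^B$ on $\mathbb{C}^m$ and each projector $\Pi_i^B$ in it, $\mathrm{marg}_A(\mathcal{K}^{AB})=\mathrm{marg}_A(\mathcal{K}^{AB}_B)$, where $\mathcal{K}^{AB}_B=\{H\in\mathbb{C}_h^{nm\times nm}\mid H\gneq 0\ \text{or}\ (I_n\otimes\Pi_i^B)H(I_n\otimes\Pi_i^B)\in\mathcal{K}^{AB}\}$. Epistemic irrelevance of $B$ to $A$ is defined by exchanging the roles of $A$ and $B$: for each projector $\Pi_i^A$ of each projection measurement on $\mathbb{C}^n$, $\mathrm{marg}_B(\mathcal{K}^{AB})=\mathrm{marg}_B(\mathcal{K}^{AB}_A)$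 with $\mathcal{K}^{AB}_A=\{H\in\mathbb{C}_h^{nm\times nm}\mid H\gneq 0\ \text{or}\ (\Pi_i^A\otimes I_m)H(\Pi_i^A\otimes I_m)\in\mathcal{K}^{AB}\}$. $\mathcal{K}^{AB}$ satisfies epistemic independence of $A$ and $B$ if it satisfies both irrelevances.
   Formalization: The formal theorem also assumes Tr(Π_i^A ρ^A Π_i^A) > 0 for every projector of every projection measurement on C^n; without this the claim fails, e.g. n = m = 2, ρ^A = |1><1|, ρ^B = I/2. *)

theory Defs
  imports "HOL-Analysis.Analysis"
begin

type_synonym 'k cmat = "complex ^ 'k ^ 'k"

definition dagger :: "'k::finite cmat \<Rightarrow> 'k cmat" where
  "dagger G = (\<chi> i j. cnj (G $ j $ i))"

definition hermitian :: "'k::finite cmat \<Rightarrow> bool" where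
  "hermitian G \<longleftrightarrow> dagger G = G"

definition sesq_form :: "'k::finite cmat \<Rightarrow> complex ^ 'k \<Rightarrow> complex" where
  "sesq_form G v = (\<Sum>i\<in>UNIV. \<Sum>j\<in>UNIV. cnj (v $ i) * G $ i $ j * v $ j)"

text \<open>
  For Hermitian matrices the form above and the trace inner product below take real values,
  so that \<^const>\<open>Re\<close> only changes the type from complex to real.
\<close>

definition pos_semidef :: "'k::finite cmat \<Rightarrow> bool" where
  "pos_semidef G \<longleftrightarrow> hermitian G \<and> (\<forall>v. 0 \<le> Re (sesq_form G v))"

definition pos_def :: "'k::finite cmat \<Rightarrow> bool" where
  "pos_def G \<longleftrightarrow> hermitian G \<and> (\<forall>v. v \<noteq> 0 \<longrightarrow> 0 < Re (sesq_form G v))"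

definition pos_semidef_nz :: "'k::finite cmat \<Rightarrow> bool" where
  "pos_semidef_nz G \<longleftrightarrow> pos_semidef G \<and> G \<noteq> 0"

definition gamble_inner :: "'k::finite cmat \<Rightarrow> 'k cmat \<Rightarrow> real" where
  "gamble_inner G R = Re (trace (dagger G ** R))"

definition density_matrix :: "'k::finite cmat \<Rightarrow> bool" where
  "density_matrix \<rho> \<longleftrightarrow> pos_semidef \<rho> \<and> trace \<rho> = 1"

definition SDG :: "'k::finite cmat set \<Rightarrow> bool" where
  "SDG K \<longleftrightarrow>
     K \<subseteq> {G. hermitian G} \<and>
     (\<forall>G\<in>K. \<forall>H\<in>K. G + H \<in> K) \<and>
     (\<forall>G\<in>K. \<forall>\<nu>::real. \<nu> > 0 \<longrightarrow> \<nu> *\<^sub>R G \<in> K) \<and>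
     0 \<notin> K \<and>
     (\<forall>G. pos_semidef_nz G \<longrightarrow> G \<in> K) \<and>
     (\<forall>G\<in>K. pos_semidef_nz G \<or> (\<exists>\<Delta>. pos_def \<Delta> \<and> G - \<Delta> \<in> K))"

definition maximal_SDG :: "'k::finite cmat set \<Rightarrow> bool" where
  "maximal_SDG K \<longleftrightarrow> SDG K \<and> (\<forall>K'. SDG K' \<and> K \<subseteq> K' \<longrightarrow> K' = K)"

definition dual_SDG :: "'k::finite cmat set \<Rightarrow> 'k cmat set" where
  "dual_SDG K = {\<rho>. density_matrix \<rho> \<and> (\<forall>G\<in>K. 0 \<le> gamble_inner G \<rho>)}"

text \<open>
  The family is indexed by the same type as the coordinates, so it has exactly as many
  members as the dimension of the space.
\<close>

definition projection_measurement :: "('k::finite \<Rightarrow> 'k cmat) \<Rightarrow> bool" where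
  "projection_measurement P \<longleftrightarrow>
     (\<forall>i. hermitian (P i) \<and> P i \<noteq> 0 \<and> P i ** P i = P i) \<and>
     (\<forall>i j. i \<noteq> j \<longrightarrow> P i ** P j = 0) \<and>
     (\<Sum>i\<in>UNIV. P i) = mat 1"

text \<open>
  The composite of systems with coordinates \<^typ>\<open>'n::finite\<close> and \<^typ>\<open>'m::finite\<close> has
  coordinates \<^typ>\<open>'n::finite \<times> 'm::finite\<close>, of which there are \<open>CARD('n) * CARD('m)\<close>.
\<close>

definition kron :: "'n::finite cmat \<Rightarrow> 'm::finite cmat \<Rightarrow> ('n \<times> 'm) cmat"
    (infixl "\<otimes>\<^sub>k" 75) where
  "G \<otimes>\<^sub>k R = (\<chi> p q. G $ fst p $ fst q * R $ snd p $ snd q)"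

definition marg_A :: "('n::finite \<times> 'm::finite) cmat set \<Rightarrow> 'n cmat set" where
  "marg_A K = {G. hermitian G \<and> G \<otimes>\<^sub>k (mat 1 :: 'm cmat) \<in> K}"

definition marg_B :: "('n::finite \<times> 'm::finite) cmat set \<Rightarrow> 'm cmat set" where
  "marg_B K = {G. hermitian G \<and> (mat 1 :: 'n cmat) \<otimes>\<^sub>k G \<in> K}"

definition cond_B ::
  "('n::finite \<times> 'm::finite) cmat set \<Rightarrow> 'm cmat \<Rightarrow> ('n \<times> 'm) cmat set" where
  "cond_B K Q = {H. hermitian H \<and>
     (pos_semidef_nz H \<or>
      ((mat 1 :: 'n cmat) \<otimes>\<^sub>k Q) ** H ** ((mat 1 :: 'n cmat) \<otimes>\<^sub>k Q) \<in> K)}"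

definition cond_A ::
  "('n::finite \<times> 'm::finite) cmat set \<Rightarrow> 'n cmat \<Rightarrow> ('n \<times> 'm) cmat set" where
  "cond_A K Q = {H. hermitian H \<and>
     (pos_semidef_nz H \<or>
      (Q \<otimes>\<^sub>k (mat 1 :: 'm cmat)) ** H ** (Q \<otimes>\<^sub>k (mat 1 :: 'm cmat)) \<in> K)}"

definition irrelevance_A_to_B :: "('n::finite \<times> 'm::finite) cmat set \<Rightarrow> bool" where
  "irrelevance_A_to_B K \<longleftrightarrow>
     (\<forall>P. projection_measurement P \<longrightarrow> (\<forall>i. marg_A K = marg_A (cond_B K (P i))))"

definition irrelevance_B_to_A :: "('n::finite \<times> 'm::finite) cmat set \<Rightarrow> bool" where
  "irrelevance_B_to_A K \<longleftrightarrow>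
     (\<forall>P. projection_measurement P \<longrightarrow> (\<forall>i. marg_B K = marg_B (cond_A K (P i))))"

definition epistemic_independence :: "('n::finite \<times> 'm::finite) cmat set \<Rightarrow> bool" where
  "epistemic_independence K \<longleftrightarrow> irrelevance_A_to_B K \<and> irrelevance_B_to_A K"

end

theory Submission
  imports Defs
begin

text \<open>
  A maximal \<open>K\<close> whose dual is a singleton \<open>{\<rho>}\<close> is exactly the set of Hermitian \<open>G\<close> that are
  nonzero positive semi-definite or satisfy \<open>G \<bullet> \<rho> > 0\<close>: by (S3), \<open>K\<close> is contained in this set,
  which is itself an SDG.  For \<open>\<rho> = \<rho>A \<otimes> \<rho>B\<close>, conditioning \<open>G \<otimes> I\<close> on a projector \<open>Q\<close> gives
  \<open>G \<otimes> Q\<close>, and \<open>(G \<otimes> Q) \<bullet> \<rho> = (G \<bullet> \<rho>A) (Q \<bullet> \<rho>B)\<close> has the sign of \<open>G \<bullet> \<rho>A\<close> because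
  \<open>Q \<bullet> \<rho>B > 0\<close>; and if \<open>G \<otimes> Q\<close> is nonzero positive semi-definite, so is \<open>G \<otimes> I\<close>.
\<close>

section \<open>Hermitian matrices, their quadratic forms and the trace inner product\<close>

lemma sum_UNIV_prod:
  "(\<Sum>p\<in>UNIV. f p) = (\<Sum>i\<in>UNIV. \<Sum>k\<in>UNIV. f (i, k))"
  for f :: "'a::finite \<times> 'b::finite \<Rightarrow> 'c::comm_monoid_add"
  by (simp add: UNIV_Times_UNIV[symmetric] sum.cartesian_product del: UNIV_Times_UNIV)

lemma hermitian_nth: "hermitian G \<Longrightarrow> cnj (G $ j $ i) = G $ i $ j"
  unfolding hermitian_def dagger_def by (metis vec_lambda_beta)

lemma hermitianI: "(\<And>i j. cnj (G $ j $ i) = G $ i $ j) \<Longrightarrow> hermitian G"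
  unfolding hermitian_def dagger_def by (simp add: vec_eq_iff)

lemma hermitian_add: "hermitian G \<Longrightarrow> hermitian H \<Longrightarrow> hermitian (G + H)"
  by (rule hermitianI) (simp add: hermitian_nth)

lemma hermitian_diff: "hermitian G \<Longrightarrow> hermitian H \<Longrightarrow> hermitian (G - H)"
  by (rule hermitianI) (simp add: hermitian_nth)

lemma hermitian_scaleR: "hermitian G \<Longrightarrow> hermitian (c *\<^sub>R G)"
  by (rule hermitianI) (simp add: hermitian_nth)

lemma hermitian_mat_1: "hermitian (mat 1)"
  by (rule hermitianI) (simp add: mat_def)

lemma sesq_form_add: "sesq_form (G + H) v = sesq_form G v + sesq_form H v"
  by (simp add: sesq_form_def algebra_simps sum.distrib)

lemma sesq_form_diff: "sesq_form (G - H) v = sesq_form G v - sesq_form H v"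
  by (simp add: sesq_form_def algebra_simps sum_subtractf)

lemma sesq_form_scaleR: "sesq_form (c *\<^sub>R G) v = c *\<^sub>R sesq_form G v"
  by (simp add: sesq_form_def scaleR_sum_right)

lemma sesq_form_scaleR_vec: "sesq_form G (c *\<^sub>R v) = (c\<^sup>2) *\<^sub>R sesq_form G v"
  by (simp add: sesq_form_def scaleR_sum_right power2_eq_square)

lemma sesq_form_axis: "sesq_form G (axis k 1) = G $ k $ k"
proof -
  have "sesq_form G (axis k 1) = (\<Sum>i\<in>UNIV. \<Sum>j\<in>UNIV. if j = k then (if i = k then G $ i $ j else 0) else 0)"
    unfolding sesq_form_def axis_def by (intro sum.cong refl) auto
  then show ?thesis by simp
qed

lemma Re_sesq_form_mat_1: "Re (sesq_form (mat 1) v) = (norm v)\<^sup>2"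
proof -
  have "sesq_form (mat 1) v = (\<Sum>i\<in>UNIV. \<Sum>j\<in>UNIV. if j = i then cnj (v $ i) * v $ i else 0)"
    unfolding sesq_form_def mat_def by (intro sum.cong refl) auto
  also have "\<dots> = (\<Sum>i\<in>UNIV. cnj (v $ i) * v $ i)" by simp
  also have "\<dots> = (\<Sum>i\<in>UNIV. of_real ((norm (v $ i))\<^sup>2))"
    by (intro sum.cong refl) (metis complex_norm_square mult.commute)
  finally show ?thesis
    by (simp add: norm_vec_def L2_set_def sum_nonneg)
qed

lemma gamble_inner_eq_sum:
  "gamble_inner G R = (\<Sum>i\<in>UNIV. \<Sum>j\<in>UNIV. Re (cnj (G $ j $ i) * R $ j $ i))"
  by (simp add: gamble_inner_def trace_def dagger_def matrix_matrix_mult_def)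

lemma gamble_inner_add: "gamble_inner (G + H) R = gamble_inner G R + gamble_inner H R"
  by (simp add: gamble_inner_eq_sum algebra_simps sum.distrib)

lemma gamble_inner_diff: "gamble_inner (G - H) R = gamble_inner G R - gamble_inner H R"
  by (simp add: gamble_inner_eq_sum algebra_simps sum.distrib sum_subtractf)

lemma gamble_inner_scaleR: "gamble_inner (c *\<^sub>R G) R = c * gamble_inner G R"
  by (simp add: gamble_inner_eq_sum sum_distrib_left algebra_simps)

lemma gamble_inner_0: "gamble_inner 0 R = 0"
  by (simp add: gamble_inner_eq_sum)

lemma gamble_inner_mat_1: "gamble_inner (mat 1) R = Re (trace R)"
  by (simp add: gamble_inner_def hermitian_mat_1[unfolded hermitian_def])

section \<open>Positive definiteness and the shape of maximal SDGs\<close>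

text \<open>By compactness the form of \<open>D\<close> attains a minimum \<open>e > 0\<close> on
  the unit sphere, and homogeneity of degree two carries this bound to all vectors. It makes the
  (S3) slack comparable to the identity.\<close>

lemma pos_def_ge_scaled_identity:
  fixes D :: "'k::finite cmat"
  assumes "pos_def D"
  shows "\<exists>e>0. pos_semidef (D - e *\<^sub>R mat 1)"
proof -
  let ?S = "sphere (0 :: complex ^ 'k) 1"
  have cont: "continuous_on ?S (\<lambda>v. Re (sesq_form D v))"
    unfolding sesq_form_def by (intro continuous_intros)
  \<comment> \<open>Any coordinate vector shows that the sphere is nonempty; the index is
    arbitrary.\<close>
  have "axis undefined 1 \<in> ?S" by simp
  then have "?S \<noteq> {}" by blast
  then obtain w where w: "w \<in> ?S" "\<And>v. v \<in> ?S \<Longrightarrow> Re (sesq_form D w) \<le> Re (sesq_form D v)"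
    using continuous_attains_inf[OF compact_sphere _ cont] by blast
  define e where "e = Re (sesq_form D w)"
  from w(1) have "w \<noteq> 0" by auto
  with assms have "e > 0" by (simp add: pos_def_def e_def)
  moreover have "e * (norm v)\<^sup>2 \<le> Re (sesq_form D v)" for v
  proof (cases "v = 0")
    case True
    then show ?thesis by (simp add: sesq_form_def)
  next
    case False
    define u where "u = (1 / norm v) *\<^sub>R v"
    have "u \<in> ?S" and v: "norm v *\<^sub>R u = v" using False by (auto simp: u_def)
    then have "e \<le> Re (sesq_form D u)" using w(2) e_def by simp
    then have "e * (norm v)\<^sup>2 \<le> (norm v)\<^sup>2 * Re (sesq_form D u)"
      by (subst mult.commute) (rule mult_left_mono, simp_all)
    also have "\<dots> = Re (sesq_form D v)"
      using sesq_form_scaleR_vec[of D "norm v" u] by (simp add: v)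
    finally show ?thesis .
  qed
  then have "pos_semidef (D - e *\<^sub>R mat 1)"
    using assms
    by (auto simp: pos_semidef_def pos_def_def sesq_form_diff sesq_form_scaleR
        Re_sesq_form_mat_1 intro: hermitian_diff hermitian_scaleR hermitian_mat_1)
  ultimately show ?thesis by blast
qed

lemma pos_semidef_add: "pos_semidef G \<Longrightarrow> pos_semidef H \<Longrightarrow> pos_semidef (G + H)"
  by (simp add: pos_semidef_def hermitian_add sesq_form_add)

lemma pos_semidef_nz_scaleR: "pos_semidef_nz G \<Longrightarrow> c > 0 \<Longrightarrow> pos_semidef_nz (c *\<^sub>R G)"
  by (simp add: pos_semidef_nz_def pos_semidef_def hermitian_scaleR sesq_form_scaleR)

lemma pos_def_mat_1_scaleR: "c > 0 \<Longrightarrow> pos_def (c *\<^sub>R mat 1)"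
  by (simp add: pos_def_def hermitian_scaleR hermitian_mat_1 sesq_form_scaleR Re_sesq_form_mat_1)

text \<open>By (S3), an element of \<open>K\<close> outside the positive semi-definite cone is an
  element of \<open>K\<close> plus a positive definite matrix; the former pairs nonnegatively with
  \<open>\<rho>\<close>, the latter strictly positively. Maximality then turns the inclusion in an
  SDG into equality.\<close>

lemma maximal_SDG_eq:
  fixes K :: "'k::finite cmat set"
  assumes max: "maximal_SDG K" and "\<rho> \<in> dual_SDG K"
  shows "K = {G. hermitian G \<and> (pos_semidef_nz G \<or> 0 < gamble_inner G \<rho>)}" (is "_ = ?K'")
proof -
  have dual: "0 \<le> gamble_inner G \<rho>" if "G \<in> K" for G
    using assms(2) that by (simp add: dual_SDG_def)
  have "trace \<rho> = 1"
    using assms(2) by (simp add: dual_SDG_def density_matrix_def)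
  then have id: "gamble_inner (mat 1) \<rho> = 1"
    by (simp add: gamble_inner_mat_1)
  have K: "SDG K" using max by (simp add: maximal_SDG_def)
  then have psdK: "G \<in> K" if "pos_semidef_nz G" for G
    using that by (simp add: SDG_def)
  \<comment> \<open>The sum cannot vanish because it lies in \<open>K\<close>, which omits
    0.\<close>
  have psd_sum: "pos_semidef_nz (G + H)" if "pos_semidef_nz G" "pos_semidef_nz H" for G H :: "'k cmat"
  proof -
    have "G + H \<in> K" using that psdK K by (simp add: SDG_def)
    then have "G + H \<noteq> 0" using K by (auto simp: SDG_def)
    then show ?thesis using that by (simp add: pos_semidef_nz_def pos_semidef_add)
  qed
  \<comment> \<open>\<open>D - e *\<^sub>R mat 1\<close> is zero or in \<open>K\<close>, so it pairs
    nonnegatively with \<open>\<rho>\<close>; the identity pairs to 1, which leaves at least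
    \<open>e\<close>.\<close>
  have pd: "0 < gamble_inner D \<rho>" if D: "pos_def D" for D
  proof -
    obtain e where e: "e > 0" "pos_semidef (D - e *\<^sub>R mat 1)"
      using pos_def_ge_scaled_identity[OF D] by blast
    have "0 \<le> gamble_inner (D - e *\<^sub>R mat 1) \<rho>"
      using e(2) dual psdK by (cases "D - e *\<^sub>R mat 1 = 0") (auto simp: pos_semidef_nz_def gamble_inner_0)
    then show ?thesis
      using e(1) by (simp add: gamble_inner_diff gamble_inner_scaleR id)
  qed
  have "K \<subseteq> ?K'"
  proof
    fix G assume G: "G \<in> K"
    have "0 < gamble_inner G \<rho>" if "pos_def D" "G - D \<in> K" for D
      using pd[OF that(1)] dual[OF that(2)] by (simp add: gamble_inner_diff)
    moreover have "pos_semidef_nz G \<or> (\<exists>\<Delta>. pos_def \<Delta> \<and> G - \<Delta> \<in> K)" "hermitian G"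
      using G K unfolding SDG_def by blast+
    ultimately show "G \<in> ?K'" by blast
  qed
  moreover have "SDG ?K'"
    unfolding SDG_def
  proof (intro conjI ballI allI impI)
    fix G H assume G: "G \<in> ?K'" and H: "H \<in> ?K'"
    \<comment> \<open>A sum with at least one strictly positive pairing is then strictly positive;
      the remaining case, two semi-definite summands, is \<open>psd_sum\<close>.\<close>
    have "0 \<le> gamble_inner F \<rho>" if "F \<in> ?K'" for F
      using that dual[OF psdK, of F] by auto
    note nonneg = this[OF G] this[OF H]
    show "G + H \<in> ?K'"
      using G H nonneg psd_sum[of G H] by (auto simp: hermitian_add gamble_inner_add)
  next
    fix G assume G: "G \<in> ?K'"
    show "pos_semidef_nz G \<or> (\<exists>\<Delta>. pos_def \<Delta> \<and> G - \<Delta> \<in> ?K')"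
    proof (cases "pos_semidef_nz G")
      case False
      \<comment> \<open>Half the pairing: since \<open>\<rho>\<close> has trace one, subtracting
        \<open>e\<close> times the identity leaves exactly \<open>e > 0\<close>.\<close>
      define e where "e = gamble_inner G \<rho> / 2"
      have "e > 0" using G False by (simp add: e_def)
      then have "pos_def (e *\<^sub>R mat 1 :: 'k cmat)" "0 < gamble_inner (G - e *\<^sub>R mat 1) \<rho>"
        by (simp_all add: pos_def_mat_1_scaleR gamble_inner_diff gamble_inner_scaleR id e_def)
      then show ?thesis
        using G by (auto intro!: exI[of _ "e *\<^sub>R mat 1"] simp: hermitian_diff hermitian_scaleR hermitian_mat_1)
    qed simp
  qed (auto simp: hermitian_scaleR pos_semidef_nz_scaleR gamble_inner_scaleR gamble_inner_0
      pos_semidef_nz_def pos_semidef_def sesq_form_scaleR)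
  ultimately show ?thesis using max unfolding maximal_SDG_def by blast
qed

section \<open>Kronecker products\<close>

lemma kron_matrix_mult: "(A \<otimes>\<^sub>k B) ** (C \<otimes>\<^sub>k D) = (A ** C) \<otimes>\<^sub>k (B ** D)"
  by (simp add: vec_eq_iff kron_def matrix_matrix_mult_def sum_UNIV_prod sum_product mult_ac)

lemma dagger_kron: "dagger (A \<otimes>\<^sub>k B) = dagger A \<otimes>\<^sub>k dagger B"
  by (simp add: vec_eq_iff kron_def dagger_def)

lemma trace_kron: "trace (A \<otimes>\<^sub>k B) = trace A * trace B"
  by (simp add: trace_def kron_def sum_UNIV_prod sum_product)

lemma hermitian_kron: "hermitian A \<Longrightarrow> hermitian B \<Longrightarrow> hermitian (A \<otimes>\<^sub>k B)"
  by (simp add: hermitian_def dagger_kron)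

text \<open>Conjugation reverses the product, and the trace is cyclic.\<close>

lemma Im_trace_mult_hermitian:
  assumes "hermitian A" "hermitian B"
  shows "Im (trace (A ** B)) = 0"
proof -
  have "cnj (trace (A ** B)) = trace (B ** A)"
    by (simp add: trace_def matrix_matrix_mult_def hermitian_nth[OF assms(1)]
        hermitian_nth[OF assms(2)] mult.commute)
  also have "\<dots> = trace (A ** B)" by (rule trace_mul_sym)
  finally show ?thesis by (auto dest: arg_cong[of _ _ Im])
qed

text \<open>The trace factorises, and the real part of a product of two complex numbers factorises
  once one of them is real, here the trace of \<open>B ** D\<close>.\<close>

lemma gamble_inner_kron:
  assumes "hermitian B" "hermitian D"
  shows "gamble_inner (A \<otimes>\<^sub>k B) (C \<otimes>\<^sub>k D) = gamble_inner A C * gamble_inner B D"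
  using Im_trace_mult_hermitian[OF assms] assms
  by (simp add: gamble_inner_def dagger_kron kron_matrix_mult trace_kron hermitian_def)

text \<open>The vector on the left is the product vector of \<open>x\<close> and
  \<open>y\<close>.\<close>

lemma sesq_form_kron:
  "sesq_form (A \<otimes>\<^sub>k B) (\<chi> p. x $ fst p * y $ snd p) = sesq_form A x * sesq_form B y"
proof -
  have "sesq_form (A \<otimes>\<^sub>k B) (\<chi> p. x $ fst p * y $ snd p)
    = (\<Sum>i\<in>UNIV. \<Sum>k\<in>UNIV. \<Sum>j\<in>UNIV. \<Sum>l\<in>UNIV.
        (cnj (x $ i) * A $ i $ j * x $ j) * (cnj (y $ k) * B $ k $ l * y $ l))"
    by (simp add: sesq_form_def kron_def sum_UNIV_prod algebra_simps)
  also have "\<dots> = sesq_form A x * sesq_form B y"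
    by (simp add: sesq_form_def sum_product)
  finally show ?thesis .
qed

text \<open>Up to reordering coordinates the matrix is block diagonal with copies of
  \<open>A\<close>, one for each slice of \<open>v\<close>.\<close>

lemma sesq_form_kron_mat_1:
  "sesq_form (A \<otimes>\<^sub>k mat 1) v = (\<Sum>k\<in>UNIV. sesq_form A (\<chi> i. v $ (i, k)))"
proof -
  have "sesq_form (A \<otimes>\<^sub>k mat 1) v = (\<Sum>i\<in>UNIV. \<Sum>k\<in>UNIV. \<Sum>j\<in>UNIV. \<Sum>l\<in>UNIV.
      if l = k then cnj (v $ (i, k)) * A $ i $ j * v $ (j, k) else 0)"
    unfolding sesq_form_def sum_UNIV_prod
    by (intro sum.cong refl) (auto simp: kron_def mat_def)
  also have "\<dots> = (\<Sum>i\<in>UNIV. \<Sum>k\<in>UNIV. \<Sum>j\<in>UNIV. cnj (v $ (i, k)) * A $ i $ j * v $ (j, k))"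
    by simp
  also have "\<dots> = (\<Sum>k\<in>UNIV. sesq_form A (\<chi> i. v $ (i, k)))"
    by (subst sum.swap) (simp add: sesq_form_def)
  finally show ?thesis .
qed

section \<open>Positivity of products with a projector\<close>

text \<open>As \<open>Q\<close> is Hermitian and idempotent, each diagonal entry is the squared norm
  of its row, and some row is nonzero.\<close>

lemma projector_diagonal_pos:
  assumes "hermitian Q" "Q \<noteq> 0" "Q ** Q = Q"
  obtains k where "0 < Re (Q $ k $ k)" "Im (Q $ k $ k) = 0"
proof -
  obtain k l where kl: "Q $ k $ l \<noteq> 0"
    using assms(2) by (auto simp: vec_eq_iff)
  have "Q $ k $ k = (\<Sum>j\<in>UNIV. Q $ k $ j * Q $ j $ k)"
    by (subst assms(3)[symmetric]) (simp add: matrix_matrix_mult_def)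
  also have "\<dots> = (\<Sum>j\<in>UNIV. of_real ((norm (Q $ k $ j))\<^sup>2))"
    by (intro sum.cong refl) (metis complex_norm_square hermitian_nth[OF assms(1)])
  finally have eq: "Q $ k $ k = of_real (\<Sum>j\<in>UNIV. (norm (Q $ k $ j))\<^sup>2)" by simp
  have "0 < (\<Sum>j\<in>UNIV. (norm (Q $ k $ j))\<^sup>2)"
    using kl by (intro sum_pos2[where i = l]) auto
  then show ?thesis using that[of k] eq by simp
qed

text \<open>Product test vectors with second factor a basis vector \<open>axis k 1\<close>, where
  \<open>Q $ k $ k > 0\<close>, show that \<open>G\<close> is positive semi-definite; slicing then
  gives the claim for the identity.\<close>

lemma pos_semidef_nz_kron_mat_1:
  fixes G :: "'n::finite cmat" and Q :: "'m::finite cmat"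
  assumes G: "hermitian G" and Q: "hermitian Q" "Q \<noteq> 0" "Q ** Q = Q"
    and GQ: "pos_semidef_nz (G \<otimes>\<^sub>k Q)"
  shows "pos_semidef_nz (G \<otimes>\<^sub>k (mat 1 :: 'm cmat))"
proof -
  obtain k where k: "0 < Re (Q $ k $ k)" "Im (Q $ k $ k) = 0"
    using projector_diagonal_pos[OF Q] .
  have form: "0 \<le> Re (sesq_form G x)" for x
  proof -
    have "0 \<le> Re (sesq_form (G \<otimes>\<^sub>k Q) (\<chi> p. x $ fst p * axis k 1 $ snd p))"
      using GQ by (simp add: pos_semidef_nz_def pos_semidef_def)
    then show ?thesis
      using k by (simp add: sesq_form_kron sesq_form_axis zero_le_mult_iff)
  qed
  have "G \<otimes>\<^sub>k (mat 1 :: 'm cmat) \<noteq> 0"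
  proof
    assume 0: "G \<otimes>\<^sub>k (mat 1 :: 'm cmat) = 0"
    \<comment> \<open>The block with both second coordinates equal to \<open>k\<close> is a copy of
      \<open>G\<close>.\<close>
    have "G $ i $ j = 0" for i j
      using arg_cong[OF 0, of "\<lambda>M. M $ (i, k) $ (j, k)"] by (simp add: kron_def mat_def)
    then have "G \<otimes>\<^sub>k Q = 0" by (simp add: kron_def vec_eq_iff)
    with GQ show False by (simp add: pos_semidef_nz_def)
  qed
  then show ?thesis
    by (simp add: pos_semidef_nz_def pos_semidef_def hermitian_kron G hermitian_mat_1
        sesq_form_kron_mat_1 sum_nonneg form)
qed

text \<open>Exchanging the factors permutes rows and columns by the same bijection
  \<open>prod.swap\<close>. This transfers results about one subsystem to the other.\<close>

lemma pos_semidef_nz_kron_commute: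
  assumes "pos_semidef_nz (A \<otimes>\<^sub>k B)"
  shows "pos_semidef_nz (B \<otimes>\<^sub>k A)"
proof -
  have nth: "(B \<otimes>\<^sub>k A) $ (k, i) $ (l, j) = (A \<otimes>\<^sub>k B) $ (i, k) $ (j, l)" for i j k l
    by (simp add: kron_def)
  have h: "hermitian (A \<otimes>\<^sub>k B)" using assms by (simp add: pos_semidef_nz_def pos_semidef_def)
  have "hermitian (B \<otimes>\<^sub>k A)"
  proof (rule hermitianI)
    fix p q show "cnj ((B \<otimes>\<^sub>k A) $ q $ p) = (B \<otimes>\<^sub>k A) $ p $ q"
      by (cases p; cases q) (simp add: nth hermitian_nth[OF h])
  qed
  moreover have "sesq_form (B \<otimes>\<^sub>k A) v = sesq_form (A \<otimes>\<^sub>k B) (\<chi> p. v $ prod.swap p)" for v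
    unfolding sesq_form_def
    by (rule sum.reindex_bij_witness[where i = prod.swap and j = prod.swap], simp_all,
        rule sum.reindex_bij_witness[where i = prod.swap and j = prod.swap],
        auto simp: nth split: prod.splits)
  moreover have "B \<otimes>\<^sub>k A \<noteq> 0"
  proof
    assume "B \<otimes>\<^sub>k A = 0"
    then have "A \<otimes>\<^sub>k B = 0"
      by (auto simp: vec_eq_iff simp flip: nth)
    with assms show False by (simp add: pos_semidef_nz_def)
  qed
  ultimately show ?thesis
    using assms by (simp add: pos_semidef_nz_def pos_semidef_def)
qed

text \<open>Cyclicity and idempotence identify the outcome probability with a trace inner
  product.\<close>

lemma gamble_inner_projector:
  assumes "hermitian Q" "Q ** Q = Q"
  shows "gamble_inner Q \<rho> = Re (trace (Q ** \<rho> ** Q))"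
proof -
  have "trace (Q ** \<rho> ** Q) = trace (Q ** (Q ** \<rho>))" by (rule trace_mul_sym)
  also have "\<dots> = trace (Q ** \<rho>)" by (simp add: matrix_mul_assoc assms(2))
  finally show ?thesis using assms(1) by (simp add: gamble_inner_def hermitian_def)
qed

section \<open>Epistemic independence for a product state\<close>

theorem propositionA14:
  fixes K :: "('n::finite \<times> 'm::finite) cmat set"
    and \<rho>A :: "'n cmat" and \<rho>B :: "'m cmat"
  assumes "maximal_SDG K"
    and "density_matrix \<rho>A" and "density_matrix \<rho>B"
    and "dual_SDG K = {\<rho>A \<otimes>\<^sub>k \<rho>B}"
    and "\<And>P i. projection_measurement P \<Longrightarrow> 0 < Re (trace (P i ** \<rho>B ** P i))"
    and "\<And>P i. projection_measurement P \<Longrightarrow> 0 < Re (trace (P i ** \<rho>A ** P i))"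
  shows "epistemic_independence K"
proof -
  have herm: "hermitian \<rho>A" "hermitian \<rho>B" and tr: "trace \<rho>A = 1" "trace \<rho>B = 1"
    using assms(2,3) by (auto simp: density_matrix_def pos_semidef_def)
  have mem: "G \<otimes>\<^sub>k R \<in> K \<longleftrightarrow>
      pos_semidef_nz (G \<otimes>\<^sub>k R) \<or> 0 < gamble_inner G \<rho>A * gamble_inner R \<rho>B"
    if "hermitian G" "hermitian R" for G R
    using maximal_SDG_eq[OF assms(1), of "\<rho>A \<otimes>\<^sub>k \<rho>B"] assms(4) that
    by (simp add: hermitian_kron gamble_inner_kron herm)
  note id = hermitian_mat_1 gamble_inner_mat_1 tr
  have "irrelevance_A_to_B K"
    unfolding irrelevance_A_to_B_def
  proof (intro allI impI)
    fix P :: "'m \<Rightarrow> 'm cmat" and i assume P: "projection_measurement P"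
    define Q where "Q = P i"
    have Q: "hermitian Q" "Q \<noteq> 0" "Q ** Q = Q" using P by (auto simp: projection_measurement_def Q_def)
    have pos: "0 < gamble_inner Q \<rho>B"
      using assms(5)[OF P] by (simp add: gamble_inner_projector Q(1,3)) (simp add: Q_def)
    \<comment> \<open>Both \<open>mat 1\<close> and \<open>Q\<close> pair positively with
      \<open>\<rho>B\<close>, so the strict inequality in \<open>mem\<close> reduces to the sign of
      \<open>gamble_inner G \<rho>A\<close> in either case.\<close>
    have "G \<otimes>\<^sub>k mat 1 \<in> K \<longleftrightarrow> pos_semidef_nz (G \<otimes>\<^sub>k (mat 1 :: 'm cmat)) \<or> G \<otimes>\<^sub>k Q \<in> K"
      if "hermitian G" for G
      using that Q pos pos_semidef_nz_kron_mat_1[OF that Q]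
      by (auto simp: mem id zero_less_mult_iff)
    then show "marg_A K = marg_A (cond_B K (P i))"
      by (auto simp: marg_A_def cond_B_def kron_matrix_mult hermitian_kron id Q(3) simp flip: Q_def)
  qed
  moreover have "irrelevance_B_to_A K"
    unfolding irrelevance_B_to_A_def
  proof (intro allI impI)
    fix P :: "'n \<Rightarrow> 'n cmat" and i assume P: "projection_measurement P"
    define Q where "Q = P i"
    have Q: "hermitian Q" "Q \<noteq> 0" "Q ** Q = Q" using P by (auto simp: projection_measurement_def Q_def)
    \<comment> \<open>This direction conditions on projectors of the first system, so it draws on
      the positivity assumption for \<open>\<rho>A\<close>.\<close>
    have pos: "0 < gamble_inner Q \<rho>A"
      using assms(6)[OF P] by (simp add: gamble_inner_projector Q(1,3)) (simp add: Q_def)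
    \<comment> \<open>For the semi-definite case the factors of \<open>Q \<otimes>\<^sub>k G\<close>
      are swapped, \<open>Q\<close> is replaced by the identity, and the factors are swapped
      back.\<close>
    have "mat 1 \<otimes>\<^sub>k G \<in> K \<longleftrightarrow> pos_semidef_nz ((mat 1 :: 'n cmat) \<otimes>\<^sub>k G) \<or> Q \<otimes>\<^sub>k G \<in> K"
      if "hermitian G" for G
      using that Q pos
        pos_semidef_nz_kron_mat_1[OF that Q, THEN pos_semidef_nz_kron_commute,
          OF pos_semidef_nz_kron_commute]
      by (auto simp: mem id zero_less_mult_iff)
    then show "marg_B K = marg_B (cond_A K (P i))"
      by (auto simp: marg_B_def cond_A_def kron_matrix_mult hermitian_kron id Q(3) simp flip: Q_def)
  qed
  ultimately show ?thesis by (simp add: epistemic_independence_def)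
qed

end
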